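(* Let $E$ be a Dedekind complete lattice-ordered field (which is also a Riesz space with the same addition and order) with a conditional expectation $T$ and a weak order unit $e$ such that $T(e)=e$. Suppose $B_1,\dots,B_n$ are $n$ mutually disjoint nonempty projection bands in $E$ such that $E=B_1\oplus B_2\oplus\cdots\oplus B_n$, and let $P_{B_i}$ be the band projection onto $B_i$ ($1\leq i\leq n$). Then for any projection band $D$ in $E$ with associated band projection $P_D$, any $1\leq j\leq n$, and every $f\in E$ such that $TP_{B_i}(f)\neq 0$ for all $1\leq i\leq n$ and $TP_D(f)\neq 0$, $$P_{B_j\mid D}(f)=\Bigl[\bigl(P_{D\mid B_j}(f)\bigr)\bigl(TP_{B_j}(f)\bigr)\Bigr]\Bigl[\sum_{i=1}^n \bigl(P_{D\mid B_i}(f)\bigr)\bigl(TP_{B_i}(f)\bigr)\Bigr]^{-1},$$ where $P_{C_1\mid C_2}$ denotes the conditional probability of $C_1$ given $C_2$ with respect to $T$.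
   Context: Riesz space notions. A Riesz space is a real ordered vector space that is a lattice; $|x|=x\vee(-x)$. It is Dedekind complete if every nonempty subset bounded from above has a supremum. A Riesz subspace is a vector subspace closed under the lattice operations. An ideal is a vector subspace $Y$ such that $|x|\leq|y|$, $y\in Y$ imply $x\in Y$. A net $(x_\alpha)$ order-converges to $x$ if there is a net $(y_\alpha)$ with the same index set with $|x_\alpha-x|\leq y_\alpha\downarrow0$. A band is an order-closed ideal. The disjoint complement of $A$ is $A^d=\{x\mid |x|\wedge|y|=0\ \forall y\in A\}$; two bands are disjoint if $|x|\wedge|y|=0$ for all $x$ in one and $y$ in the other. A band $B$ in $X$ is a projection band if $X=B\oplus B^d$, and its band projection $P_B:X\to X$ sends $x=x_1+x_2$ ($x_1\in B$, $x_2\in B^d$) to $x_1$. A weak order unit is an element $e>0$ such that the band generated by $e$ is the whole space. Lattice-ordered field. A field $F$ with a partial order $\leq$ is a partially ordered field if (a) $x\leq y$ implies $x+z\leq y+z$ for all $z$; (b) $x>y$ and $z>0$ imply $xz>yz$; (c) $1>0$, where $1$ is the multiplicative identity. It is a lattice-ordered field if in addition its additive group is a lattice-ordered group, i.e. the order is a lattice order. Here $E$ carries both a lattice-ordered field structure and a Riesz space structure, with the same addition and the same order; products and inverses of elements of $E$ are taken in the field $E$. Conditional expectation. A conditional expectation on a Riesz space $X$ with a weak order unit is a linear operator $T:X\to X$ that is a projection ($T^2=T$), positive ($x\geq0$ implies $T(x)\geq0$) and order-continuous ($x_\alpha$ order-converging to $0$ implies $T(x_\alpha)$ order-converges to $0$),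 whose range $R(T)$ is a Dedekind complete Riesz subspace of $X$, and such that $T(e)$ is a weak order unit of $X$ for every weak order unit $e$ of $X$. Conditional probability. For projection bands $C_1,C_2$ of $E$ with $C_1\cap C_2\neq\emptyset$ (automatic, since both contain $0$), the conditional probability of $C_1$ given $C_2$ with respect to $T$ is defined by $$P_{C_1\mid C_2}(f)=[TP_{C_2}P_{C_1}(f)]\,[TP_{C_2}(f)]^{-1}$$ for those $f\in E$ with $TP_{C_2}(f)\neq0$. *)

theory Defs
  imports Complex_Main "HOL-Library.FuncSet" "HOL-Library.Lub_Glb"
begin

class riesz_space = ordered_real_vector + lattice

class lattice_ordered_field = field + ordered_ab_group_add + lattice +
  assumes lof_mult_strict_right_mono: "y < x \<Longrightarrow> 0 < z \<Longrightarrow> y * z < x * z"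
    and lof_zero_less_one: "0 < 1"

text \<open>The order of a lattice-ordered field need not be total. Multiplication of the field is not
  required to be compatible with real scalar multiplication, so a type that is both a
  \<^class>\<open>lattice_ordered_field\<close> and a \<^class>\<open>riesz_space\<close> shares only addition and order
  between the two structures.\<close>

definition riesz_abs :: "'a::riesz_space \<Rightarrow> 'a" where
  "riesz_abs x = sup x (- x)"

text \<open>Dedekind completeness of a subset in the induced order: bounds and suprema are taken inside
  the subset.\<close>

definition dedekind_complete :: "'a::riesz_space set \<Rightarrow> bool" where
  "dedekind_complete Y \<longleftrightarrow>
     (\<forall>A\<subseteq>Y. A \<noteq> {} \<and> (\<exists>u. isUb Y A u) \<longrightarrow> (\<exists>s. isLub Y A s))"

definition riesz_subspace :: "'a::riesz_space set \<Rightarrow> bool" where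
  "riesz_subspace Y \<longleftrightarrow> subspace Y \<and> (\<forall>x\<in>Y. \<forall>y\<in>Y. sup x y \<in> Y \<and> inf x y \<in> Y)"

definition riesz_ideal :: "'a::riesz_space set \<Rightarrow> bool" where
  "riesz_ideal Y \<longleftrightarrow>
     subspace Y \<and> (\<forall>x y. riesz_abs x \<le> riesz_abs y \<and> y \<in> Y \<longrightarrow> x \<in> Y)"

text \<open>A net is a function restricted to a nonempty set \<open>I\<close> directed by the preorder \<open>r\<close>;
  \<open>(a, b) \<in> r\<close> means that \<open>b\<close> is later than \<open>a\<close>.\<close>

definition directed_index :: "'i set \<Rightarrow> 'i rel \<Rightarrow> bool" where
  "directed_index I r \<longleftrightarrow>
     I \<noteq> {} \<and> preorder_on I r \<and> (\<forall>a\<in>I. \<forall>b\<in>I. \<exists>c\<in>I. (a, c) \<in> r \<and> (b, c) \<in> r)"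

definition decreases_to_zero :: "'i set \<Rightarrow> 'i rel \<Rightarrow> ('i \<Rightarrow> 'a::riesz_space) \<Rightarrow> bool" where
  "decreases_to_zero I r y \<longleftrightarrow> (\<forall>(a, b)\<in>r. y b \<le> y a) \<and> isGlb UNIV (y ` I) 0"

definition order_converges ::
    "'i set \<Rightarrow> 'i rel \<Rightarrow> ('i \<Rightarrow> 'a::riesz_space) \<Rightarrow> 'a \<Rightarrow> bool" where
  "order_converges I r x l \<longleftrightarrow> directed_index I r \<and>
     (\<exists>y. decreases_to_zero I r y \<and> (\<forall>a\<in>I. riesz_abs (x a - l) \<le> y a))"

text \<open>A definition cannot quantify over all index types. Nets indexed by sets of pairs of vectors
  are enough: every order-convergent net can be reindexed by its values together with those of a
  dominating net. The lemmas \<open>order_closedD\<close> and \<open>order_continuousD\<close> below show that the two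
  definitions imply the corresponding property for nets with an arbitrary index type.\<close>

definition order_closed :: "'a::riesz_space set \<Rightarrow> bool" where
  "order_closed A \<longleftrightarrow> (\<forall>(I :: ('a \<times> 'a) set) r x l.
     order_converges I r x l \<and> (\<forall>a\<in>I. x a \<in> A) \<longrightarrow> l \<in> A)"

definition order_continuous :: "('a::riesz_space \<Rightarrow> 'a) \<Rightarrow> bool" where
  "order_continuous T \<longleftrightarrow> (\<forall>(I :: ('a \<times> 'a) set) r x.
     order_converges I r x 0 \<longrightarrow> order_converges I r (\<lambda>a. T (x a)) 0)"

lemma order_converges_reindex:
  fixes x :: "'i \<Rightarrow> 'a::riesz_space"
  assumes "order_converges I r x l"
  obtains y :: "'i \<Rightarrow> 'a" and r' where
    "order_converges ((\<lambda>a. (x a, y a)) ` I) r' fst l"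
    "\<And>a b. (a, b) \<in> r \<Longrightarrow> ((x a, y a), (x b, y b)) \<in> r'"
proof -
  from assms obtain y where dir: "directed_index I r"
    and dec: "\<And>a b. (a, b) \<in> r \<Longrightarrow> y b \<le> y a" and glb: "isGlb UNIV (y ` I) 0"
    and dom: "\<And>a. a \<in> I \<Longrightarrow> riesz_abs (x a - l) \<le> y a"
    unfolding order_converges_def decreases_to_zero_def by blast
  define J where "J = (\<lambda>a. (x a, y a)) ` I"
  define r' where "r' = {(p, q). p \<in> J \<and> q \<in> J \<and> snd q \<le> snd p}"
  have sub: "r \<subseteq> I \<times> I"
    using dir unfolding directed_index_def preorder_on_def refl_on_def by auto
  have "preorder_on J r'"
    unfolding preorder_on_def refl_on_def trans_def r'_def by auto
  moreover have "\<exists>s\<in>J. (p, s) \<in> r' \<and> (q, s) \<in> r'" if pq: "p \<in> J" "q \<in> J" for p q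
  proof -
    from pq obtain a b where ab: "a \<in> I" "b \<in> I" "p = (x a, y a)" "q = (x b, y b)"
      unfolding J_def by auto
    with dir obtain c where "c \<in> I" "(a, c) \<in> r" "(b, c) \<in> r"
      unfolding directed_index_def by blast
    then have "(x c, y c) \<in> J" "y c \<le> y a" "y c \<le> y b"
      using dec unfolding J_def by blast+
    with ab pq show ?thesis
      unfolding r'_def by (intro bexI[of _ "(x c, y c)"]) simp_all
  qed
  ultimately have "directed_index J r'"
    using dir unfolding directed_index_def J_def by blast
  moreover have "snd ` J = y ` I"
    unfolding J_def by force
  then have "decreases_to_zero J r' snd"
    using glb unfolding decreases_to_zero_def r'_def by auto
  moreover have "\<forall>p\<in>J. riesz_abs (fst p - l) \<le> snd p"
    using dom unfolding J_def by auto
  ultimately have "order_converges J r' fst l"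
    unfolding order_converges_def by blast
  moreover have "((x a, y a), (x b, y b)) \<in> r'" if "(a, b) \<in> r" for a b
    using that sub dec unfolding r'_def J_def by auto
  ultimately show thesis
    using that unfolding J_def by blast
qed

lemma order_closedD:
  fixes I :: "'i set"
  assumes "order_closed A" "order_converges I r x l" "\<And>a. a \<in> I \<Longrightarrow> x a \<in> A"
  shows "l \<in> A"
proof -
  obtain y :: "'i \<Rightarrow> 'a" and r' where *: "order_converges ((\<lambda>a. (x a, y a)) ` I) r' fst l"
    by (rule order_converges_reindex[OF assms(2)])
  have "\<forall>p\<in>(\<lambda>a. (x a, y a)) ` I. fst p \<in> A"
    using assms(3) by auto
  then show ?thesis
    using assms(1)[unfolded order_closed_def, rule_format, of _ _ fst l] * by blast
qed

lemma order_continuousD: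
  fixes I :: "'i set"
  assumes "order_continuous T" "order_converges I r x 0"
  shows "order_converges I r (\<lambda>a. T (x a)) 0"
proof -
  obtain y :: "'i \<Rightarrow> 'a" and r' where *: "order_converges ((\<lambda>a. (x a, y a)) ` I) r' fst 0"
    and mono: "\<And>a b. (a, b) \<in> r \<Longrightarrow> ((x a, y a), (x b, y b)) \<in> r'"
    by (rule order_converges_reindex[OF assms(2)]) (rule that)
  have "order_converges ((\<lambda>a. (x a, y a)) ` I) r' (\<lambda>p. T (fst p)) 0"
    using assms(1)[unfolded order_continuous_def, rule_format, OF *] .
  then obtain z where z: "decreases_to_zero ((\<lambda>a. (x a, y a)) ` I) r' z"
    and dom: "\<And>a. a \<in> I \<Longrightarrow> riesz_abs (T (x a) - 0) \<le> z (x a, y a)"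
    unfolding order_converges_def by auto
  have "decreases_to_zero I r (\<lambda>a. z (x a, y a))"
    using z mono unfolding decreases_to_zero_def image_image by blast
  with dom assms(2) show ?thesis
    unfolding order_converges_def by blast
qed

definition band :: "'a::riesz_space set \<Rightarrow> bool" where
  "band B \<longleftrightarrow> riesz_ideal B \<and> order_closed B"

definition disjoint_complement :: "'a::riesz_space set \<Rightarrow> 'a set" where
  "disjoint_complement A = {x. \<forall>y\<in>A. inf (riesz_abs x) (riesz_abs y) = 0}"

definition disjoint_bands :: "'a::riesz_space set \<Rightarrow> 'a set \<Rightarrow> bool" where
  "disjoint_bands A B \<longleftrightarrow> (\<forall>x\<in>A. \<forall>y\<in>B. inf (riesz_abs x) (riesz_abs y) = 0)"

text \<open>The whole space is the internal direct sum of the family: every vector has exactly one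
  decomposition.\<close>

definition is_direct_sum :: "'i set \<Rightarrow> ('i \<Rightarrow> 'a::riesz_space set) \<Rightarrow> bool" where
  "is_direct_sum I B \<longleftrightarrow> (\<forall>x. \<exists>!b. b \<in> (\<Pi>\<^sub>E i\<in>I. B i) \<and> x = (\<Sum>i\<in>I. b i))"

definition projection_band :: "'a::riesz_space set \<Rightarrow> bool" where
  "projection_band B \<longleftrightarrow> band B \<and>
     (\<forall>x. \<exists>!(x1, x2). x1 \<in> B \<and> x2 \<in> disjoint_complement B \<and> x = x1 + x2)"

definition band_projection :: "'a::riesz_space set \<Rightarrow> 'a \<Rightarrow> 'a" where
  "band_projection B x = (THE x1. x1 \<in> B \<and> (\<exists>x2\<in>disjoint_complement B. x = x1 + x2))"

definition weak_order_unit :: "'a::riesz_space \<Rightarrow> bool" where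
  "weak_order_unit e \<longleftrightarrow> 0 < e \<and> band hull {e} = UNIV"

definition conditional_expectation :: "('a::riesz_space \<Rightarrow> 'a) \<Rightarrow> bool" where
  "conditional_expectation T \<longleftrightarrow>
     (\<exists>e::'a. weak_order_unit e) \<and>
     linear T \<and> T \<circ> T = T \<and> (\<forall>x\<ge>0. 0 \<le> T x) \<and> order_continuous T \<and>
     riesz_subspace (range T) \<and> dedekind_complete (range T) \<and>
     (\<forall>e. weak_order_unit e \<longrightarrow> weak_order_unit (T e))"

text \<open>\<open>cond_prob T C1 C2\<close> is the conditional probability of \<open>C1\<close> given \<open>C2\<close>. It is meaningful
  only at those \<open>f\<close> with \<open>T (band_projection C2 f) \<noteq> 0\<close>.\<close>

definition cond_prob ::
    "('a::{lattice_ordered_field, riesz_space} \<Rightarrow> 'a) \<Rightarrow> 'a set \<Rightarrow> 'a set \<Rightarrow> 'a \<Rightarrow> 'a" where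
  "cond_prob T C1 C2 f =
     T (band_projection C2 (band_projection C1 f)) * inverse (T (band_projection C2 f))"

end

theory Submission
  imports Defs
begin

text \<open>Band projections commute: if \<open>f = f\<^sub>1 + f\<^sub>2\<close> along \<open>B\<close> and its complement, then splitting
  \<open>f\<^sub>1\<close> and \<open>f\<^sub>2\<close> along \<open>D\<close> stays inside these two ideals. Hence each summand
  of the denominator of Bayes' formula is \<open>T (P\<^bsub>B\<^sub>i\<^esub> (P\<^sub>D f))\<close>, and because the projections of a direct sum add up
  to the identity, the denominator is \<open>T (P\<^sub>D f)\<close>.\<close>

text \<open>\<open>x\<close> and \<open>- x\<close> cancel, so twice their common upper bound is
  nonnegative; halving by a positive real scalar keeps the sign.\<close>

lemma riesz_abs_nonneg: "0 \<le> riesz_abs x"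
proof -
  have "x \<le> riesz_abs x" "- x \<le> riesz_abs x"
    unfolding riesz_abs_def by simp_all
  then have "0 \<le> riesz_abs x + riesz_abs x"
    using add_mono by fastforce
  then have "0 \<le> (1/2) *\<^sub>R (riesz_abs x + riesz_abs x)"
    by (intro scaleR_nonneg_nonneg) simp_all
  then show ?thesis
    by simp
qed

lemma riesz_abs_zero [simp]: "riesz_abs 0 = 0"
  by (simp add: riesz_abs_def)

lemma riesz_abs_minus [simp]: "riesz_abs (- x) = riesz_abs x"
  by (simp add: riesz_abs_def sup_commute)

lemma riesz_abs_triangle: "riesz_abs (x + y) \<le> riesz_abs x + riesz_abs y"
proof -
  have "- x + - y \<le> riesz_abs x + riesz_abs y"
    by (intro add_mono) (simp_all add: riesz_abs_def)
  then show ?thesis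
    unfolding riesz_abs_def[of "x + y"] by (simp add: riesz_abs_def add_mono)
qed

text \<open>Translating the order twice is enough: \<open>?t - b\<close> lies below both
  \<open>a\<close> and \<open>c\<close>, and then \<open>?t - inf a c\<close> lies below both
  \<open>a\<close> and \<open>b\<close>.\<close>

lemma inf_add_le:
  fixes a b c :: "'a::riesz_space"
  assumes "0 \<le> a" "0 \<le> b" "0 \<le> c"
  shows "inf a (b + c) \<le> inf a b + inf a c"
proof -
  let ?t = "inf a (b + c)"
  have "?t - b \<le> a"
    using assms by (simp add: diff_le_eq add_increasing2 le_infI1)
  moreover have "?t - b \<le> c"
    by (simp add: diff_le_eq add.commute)
  ultimately have "?t - b \<le> inf a c"
    by (rule le_infI)
  then have "?t - inf a c \<le> b"
    by (metis add.commute diff_le_eq)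
  moreover have "?t - inf a c \<le> a"
    using assms by (simp add: diff_le_eq add_increasing2 le_infI1)
  ultimately have "?t - inf a c \<le> inf a b"
    by simp
  then show ?thesis
    by (simp only: diff_le_eq)
qed

text \<open>Since \<open>x = (x + y) - y\<close>, the triangle inequality bounds
  \<open>riesz_abs x\<close> by a sum, and meeting with \<open>riesz_abs x\<close> kills the
  contribution of \<open>y\<close>. This is what keeps the components of a vector inside every solid
  set containing it.\<close>

lemma riesz_abs_le_add_disjoint:
  assumes "inf (riesz_abs x) (riesz_abs y) = 0"
  shows "riesz_abs x \<le> riesz_abs (x + y)"
proof -
  have "riesz_abs x \<le> riesz_abs (x + y) + riesz_abs y"
    using riesz_abs_triangle[of "x + y" "- y"] by simp
  then have "riesz_abs x = inf (riesz_abs x) (riesz_abs (x + y) + riesz_abs y)"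
    by (simp add: inf_absorb1)
  also have "\<dots> \<le> inf (riesz_abs x) (riesz_abs (x + y)) + inf (riesz_abs x) (riesz_abs y)"
    by (intro inf_add_le riesz_abs_nonneg)
  also have "\<dots> \<le> riesz_abs (x + y)"
    using assms by simp
  finally show ?thesis .
qed

lemma disjoint_complement_solid:
  assumes "y \<in> disjoint_complement A" "riesz_abs x \<le> riesz_abs y"
  shows "x \<in> disjoint_complement A"
  unfolding disjoint_complement_def
proof (clarify, rule antisym)
  fix z assume "z \<in> A"
  then have "inf (riesz_abs y) (riesz_abs z) = 0"
    using assms(1) unfolding disjoint_complement_def by blast
  then show "inf (riesz_abs x) (riesz_abs z) \<le> 0"
    using inf_mono[OF assms(2) order_refl, of "riesz_abs z"] by simp
qed (simp add: riesz_abs_nonneg)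

text \<open>The triangle inequality and \<open>inf_add_le\<close> split the meet into two meets that
  vanish.\<close>

lemma disjoint_complement_add:
  assumes "x \<in> disjoint_complement A" "y \<in> disjoint_complement A"
  shows "x + y \<in> disjoint_complement A"
  unfolding disjoint_complement_def
proof (clarify, rule antisym)
  fix z assume z: "z \<in> A"
  have "inf (riesz_abs (x + y)) (riesz_abs z) \<le> inf (riesz_abs z) (riesz_abs x + riesz_abs y)"
    using riesz_abs_triangle[of x y] by (simp add: le_infI1)
  also have "\<dots> \<le> inf (riesz_abs z) (riesz_abs x) + inf (riesz_abs z) (riesz_abs y)"
    by (intro inf_add_le riesz_abs_nonneg)
  also have "\<dots> = 0"
    using assms z by (simp add: disjoint_complement_def inf_commute[of "riesz_abs z"])
  finally show "inf (riesz_abs (x + y)) (riesz_abs z) \<le> 0" .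
qed (simp add: riesz_abs_nonneg)

lemma zero_in_disjoint_complement: "0 \<in> disjoint_complement A"
  by (simp add: disjoint_complement_def riesz_abs_nonneg inf_absorb1)

lemma disjoint_complement_sum:
  "(\<And>i. i \<in> I \<Longrightarrow> g i \<in> disjoint_complement A) \<Longrightarrow> sum g I \<in> disjoint_complement A"
  \<comment> \<open>For infinite \<open>I\<close> the sum is 0 by default, and 0 lies in the
    complement.\<close>
  by (induction I rule: infinite_finite_induct)
    (simp_all add: zero_in_disjoint_complement disjoint_complement_add)

lemma projection_band_ideal: "projection_band B \<Longrightarrow> riesz_ideal B"
  by (simp add: projection_band_def band_def)

lemma projection_band_decompose:
  assumes "projection_band B"
  obtains x1 x2 where "x1 \<in> B" "x2 \<in> disjoint_complement B" "x = x1 + x2"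
proof -
  have "\<exists>!(x1, x2). x1 \<in> B \<and> x2 \<in> disjoint_complement B \<and> x = x1 + x2"
    using assms unfolding projection_band_def by blast
  then show thesis
    using that by auto
qed

text \<open>Uniqueness of the decomposition pins down the definite description, so a projection can
  be computed by exhibiting any valid splitting.\<close>

lemma band_projection_add:
  assumes "projection_band B" "x1 \<in> B" "x2 \<in> disjoint_complement B"
  shows "band_projection B (x1 + x2) = x1"
  unfolding band_projection_def
proof (rule the_equality)
  fix y1 assume "y1 \<in> B \<and> (\<exists>y2\<in>disjoint_complement B. x1 + x2 = y1 + y2)"
  then obtain y2 where y: "y1 \<in> B" "y2 \<in> disjoint_complement B" "x1 + x2 = y1 + y2"
    by blast
  have "\<exists>!p. case p of (z1, z2) \<Rightarrow>
      z1 \<in> B \<and> z2 \<in> disjoint_complement B \<and> x1 + x2 = z1 + z2"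
    using assms(1) unfolding projection_band_def by blast
  then have "(y1, y2) = (x1, x2)"
    by (rule ex1E) (use assms y in auto)
  then show "y1 = x1"
    by simp
qed (use assms in blast)

lemma band_projection_commute:
  assumes B: "projection_band B" and D: "projection_band D"
  shows "band_projection D (band_projection B f) = band_projection B (band_projection D f)"
proof -
  obtain f1 f2 where f: "f1 \<in> B" "f2 \<in> disjoint_complement B" "f = f1 + f2"
    using projection_band_decompose[OF B] by blast
  obtain u1 u2 where u: "u1 \<in> D" "u2 \<in> disjoint_complement D" "f1 = u1 + u2"
    using projection_band_decompose[OF D] by blast
  obtain v1 v2 where v: "v1 \<in> D" "v2 \<in> disjoint_complement D" "f2 = v1 + v2"
    using projection_band_decompose[OF D] by blast
  \<comment> \<open>The two parts along \<open>D\<close> are disjoint, so each is dominated by their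
    sum; solidity of \<open>B\<close> and of its complement then places \<open>u1\<close> and
    \<open>v1\<close>.\<close>
  have "riesz_abs u1 \<le> riesz_abs f1" "riesz_abs v1 \<le> riesz_abs f2"
    unfolding u(3) v(3)
    by (rule riesz_abs_le_add_disjoint;
        use u v in \<open>simp add: disjoint_complement_def inf_commute\<close>)+
  then have "u1 \<in> B" and "v1 \<in> disjoint_complement B"
    using projection_band_ideal[OF B] f disjoint_complement_solid
    unfolding riesz_ideal_def by blast+
  then have PBD: "band_projection B (u1 + v1) = u1"
    by (rule band_projection_add[OF B])
  have "u1 + v1 \<in> D"
    using projection_band_ideal[OF D] u v unfolding riesz_ideal_def by (blast intro: subspace_add)
  \<comment> \<open>Regrouping the four pieces of \<open>f\<close> by \<open>D\<close> instead of by
    \<open>B\<close>.\<close>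
  then have "band_projection D ((u1 + v1) + (u2 + v2)) = u1 + v1"
    using u v by (intro band_projection_add[OF D] disjoint_complement_add)
  then have "band_projection D f = u1 + v1"
    using f u v by (simp add: algebra_simps)
  moreover have "band_projection D (band_projection B f) = u1"
    using f u by (simp add: band_projection_add[OF B] band_projection_add[OF D])
  ultimately show ?thesis
    using PBD by simp
qed

lemma sum_band_projections:
  assumes "finite I" and "is_direct_sum I B"
    and band: "\<And>i. i \<in> I \<Longrightarrow> projection_band (B i)"
    and disj: "\<And>i k. i \<in> I \<Longrightarrow> k \<in> I \<Longrightarrow> i \<noteq> k \<Longrightarrow> disjoint_bands (B i) (B k)"
  shows "(\<Sum>i\<in>I. band_projection (B i) x) = x"
proof -
  obtain b where b: "b \<in> (\<Pi>\<^sub>E i\<in>I. B i)" "x = (\<Sum>i\<in>I. b i)"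
    using assms(2) unfolding is_direct_sum_def by blast
  have mem: "b i \<in> B i" if "i \<in> I" for i
    using b(1) that by (rule PiE_mem)
  have "band_projection (B i) x = b i" if i: "i \<in> I" for i
  proof -
    \<comment> \<open>All summands other than \<open>b i\<close> together form the complementary
      part of \<open>x\<close>, which makes \<open>b i\<close> its projection onto
      \<open>B i\<close>.\<close>
    have "b k \<in> disjoint_complement (B i)" if "k \<in> I - {i}" for k
      using that disj[of k i] i mem[of k]
      unfolding disjoint_bands_def disjoint_complement_def by blast
    then have "(\<Sum>k\<in>I - {i}. b k) \<in> disjoint_complement (B i)"
      by (rule disjoint_complement_sum)
    moreover have "x = b i + (\<Sum>k\<in>I - {i}. b k)"
      using b(2) i \<open>finite I\<close> by (simp add: sum.remove)
    ultimately show ?thesis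
      using band_projection_add[OF band mem] i by simp
  qed
  then show ?thesis
    using b(2) by simp
qed

theorem corollary4p1:
  fixes T :: "'a::{lattice_ordered_field, riesz_space} \<Rightarrow> 'a"
    and e f :: 'a
    and B :: "nat \<Rightarrow> 'a set"
    and D :: "'a set"
    and n j :: nat
  assumes "dedekind_complete (UNIV :: 'a set)"
    and "conditional_expectation T"
    and "weak_order_unit e" and "T e = e"
    and "\<And>i. i \<in> {1..n} \<Longrightarrow> projection_band (B i) \<and> B i \<noteq> {}"
    and "\<And>i k. i \<in> {1..n} \<Longrightarrow> k \<in> {1..n} \<Longrightarrow> i \<noteq> k \<Longrightarrow> disjoint_bands (B i) (B k)"
    and "is_direct_sum {1..n} B"
    and "projection_band D"
    and "j \<in> {1..n}"
    and "\<And>i. i \<in> {1..n} \<Longrightarrow> T (band_projection (B i) f) \<noteq> 0"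
    and "T (band_projection D f) \<noteq> 0"
  shows "cond_prob T (B j) D f =
    (cond_prob T D (B j) f * T (band_projection (B j) f)) *
    inverse (\<Sum>i = 1..n. cond_prob T D (B i) f * T (band_projection (B i) f))"
proof -
  let ?P = band_projection
  have "linear T"
    using assms(2) unfolding conditional_expectation_def by blast
  have commute: "?P D (?P (B i) f) = ?P (B i) (?P D f)" if "i \<in> {1..n}" for i
    using band_projection_commute assms(5,8) that by blast
  \<comment> \<open>The factor \<open>T (?P (B i) f)\<close> is nonzero by hypothesis and cancels
    the inverse in \<open>cond_prob\<close>.\<close>
  have term_eq: "cond_prob T D (B i) f * T (?P (B i) f) = T (?P (B i) (?P D f))"
    if "i \<in> {1..n}" for i
    using assms(10)[OF that] by (simp add: cond_prob_def mult.assoc)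
  have "(\<Sum>i = 1..n. cond_prob T D (B i) f * T (?P (B i) f)) = (\<Sum>i = 1..n. T (?P (B i) (?P D f)))"
    by (rule sum.cong[OF refl term_eq])
  also have "\<dots> = T (\<Sum>i = 1..n. ?P (B i) (?P D f))"
    by (simp add: linear_sum[OF \<open>linear T\<close>])
  also have "\<dots> = T (?P D f)"
    using sum_band_projections[OF _ assms(7)] assms(5,6) by simp
  \<comment> \<open>The \<open>j\<close>-th term is the numerator on the right; commuting its two
    projections gives the numerator of \<open>cond_prob T (B j) D f\<close>.\<close>
  finally show ?thesis
    using term_eq[OF assms(9)] commute[OF assms(9)] by (simp add: cond_prob_def)
qed

end
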